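(* Let $n\geq 7$ and $q=\frac12$. Let $G$ be the graph on vertex set $\{1,\dots,n\}$ whose edges are: the path $7,8,\dots,n$ (edges $\{k,k+1\}$ for $7\le k\le n-1$); the edges $\{7,3\},\{7,4\},\{7,5\},\{7,6\},\{3,4\},\{5,6\}$; and the edges $\{n,1\},\{n,2\},\{1,2\}$. Let $H$ be the graph on vertex set $\{1,\dots,n\}$ that is the disjoint union of the path $7,8,\dots,n$ (on $n-6$ vertices) and the graph on $\{1,\dots,6\}$ with edges $\{4,1\},\{4,2\},\{4,3\},\{4,5\},\{4,6\},\{3,1\},\{3,2\},\{3,5\},\{3,6\},\{1,2\},\{5,6\}$. Then $G$ and $H$ are cospectral for the exponential distance matrix with $q=\frac12$.
   Context: The exponential distance matrix $\mathcal{D}_q^G$ has $(u,v)$ entry $q^{\mathrm{dist}(u,v)}$, where $\mathrm{dist}$ is shortest-path distance; for vertices in different connected components the entry is $0$ (convention $q^\infty=0$). Two graphs are cospectral if their matrices have the same multiset of eigenvalues. When $n=7$, the path $7,\dots,n$ is the single vertex $7$ (so vertex $7=n$ is adjacent to $1,\dots,6$ in $G$). *)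

theory Defs
  imports
    "Graph_Theory.Arc_Walk"
    "Jordan_Normal_Form.Char_Poly"
    "HOL-Library.Extended_Nat"
    "HOL-Computational_Algebra.Fundamental_Theorem_Algebra"
begin

text \<open>
  An undirected graph with edge set \<open>E\<close> is represented by the symmetric digraph that has both
  orientations of every edge as arcs.
\<close>

definition undirected :: "'a set \<Rightarrow> 'a set set \<Rightarrow> ('a, 'a \<times> 'a) pre_digraph" where
  "undirected V E = \<lparr>verts = V, arcs = {(u, v). {u, v} \<in> E}, tail = fst, head = snd\<rparr>"

lemma graph_undirected:
  assumes "finite V" "\<And>e. e \<in> E \<Longrightarrow> e \<subseteq> V \<and> card e = 2"
  shows "graph (undirected V E)"
proof -
  have sub: "arcs (undirected V E) \<subseteq> V \<times> V"
    using assms(2) by (auto simp: undirected_def)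
  then have fin: "finite (arcs (undirected V E))"
    using assms(1) by (meson finite_SigmaI finite_subset)
  show ?thesis
  proof
    show "symmetric (undirected V E)"
      by (auto simp: symmetric_def sym_def arcs_ends_def arc_to_ends_def undirected_def
          insert_commute image_iff)
  qed (use sub fin assms in \<open>force simp: undirected_def arc_to_ends_def\<close>)+
qed

text \<open>The infimum of the empty set is \<open>\<infinity>\<close>, the distance between different components.\<close>

definition gdist :: "('a, 'b) pre_digraph \<Rightarrow> 'a \<Rightarrow> 'a \<Rightarrow> enat" where
  "gdist G u v = (INF p \<in> {p. pre_digraph.apath G u p v}. enat (length p))"

definition pow_enat :: "'a::semiring_1 \<Rightarrow> enat \<Rightarrow> 'a" where
  "pow_enat q d = (case d of enat k \<Rightarrow> q ^ k | \<infinity> \<Rightarrow> 0)"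

text \<open>Rows and columns are indexed by the vertices in increasing order.\<close>

definition exp_dist_matrix :: "real \<Rightarrow> ('a::linorder, 'b) pre_digraph \<Rightarrow> real mat" where
  "exp_dist_matrix q G =
    (let vs = sorted_list_of_set (verts G)
     in mat (length vs) (length vs) (\<lambda>(i, j). pow_enat q (gdist G (vs ! i) (vs ! j))))"

text \<open>
  Eigenvalues are taken in the complex numbers and counted with algebraic multiplicity, so that
  the multiset has as many elements as the matrix has rows.
\<close>

definition eigenvalues_mset :: "real mat \<Rightarrow> complex multiset" where
  "eigenvalues_mset A = proots (char_poly (map_mat complex_of_real A))"

lemma set_eigenvalues_mset:
  assumes "A \<in> carrier_mat n n"
  shows "set_mset (eigenvalues_mset A) = {x. eigenvalue (map_mat complex_of_real A) x}"
proof -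
  let ?A = "map_mat complex_of_real A"
  have A: "?A \<in> carrier_mat n n" using assms by simp
  have "char_poly ?A \<noteq> 0" using degree_monic_char_poly[OF A] by auto
  then show ?thesis
    using eigenvalue_root_char_poly[OF A] by (simp add: eigenvalues_mset_def)
qed

lemma size_eigenvalues_mset:
  assumes "A \<in> carrier_mat n n"
  shows "size (eigenvalues_mset A) = n"
  using degree_monic_char_poly[of "map_mat complex_of_real A" n] assms
  by (simp add: eigenvalues_mset_def size_proots_complex)

definition exp_dist_cospectral ::
    "real \<Rightarrow> ('a::linorder, 'b) pre_digraph \<Rightarrow> ('c::linorder, 'd) pre_digraph \<Rightarrow> bool" where
  "exp_dist_cospectral q G H \<longleftrightarrow>
    eigenvalues_mset (exp_dist_matrix q G) = eigenvalues_mset (exp_dist_matrix q H)"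

definition path_edges :: "nat \<Rightarrow> nat set set" where
  "path_edges n = {{k, k + 1} | k. 7 \<le> k \<and> k < n}"

definition graph_G :: "nat \<Rightarrow> (nat, nat \<times> nat) pre_digraph" where
  "graph_G n = undirected {1..n}
    (path_edges n \<union>
     {{7, 3}, {7, 4}, {7, 5}, {7, 6}, {3, 4}, {5, 6}} \<union>
     {{n, 1}, {n, 2}, {1, 2}})"

definition graph_H :: "nat \<Rightarrow> (nat, nat \<times> nat) pre_digraph" where
  "graph_H n = undirected {1..n}
    (path_edges n \<union>
     {{4, 1}, {4, 2}, {4, 3}, {4, 5}, {4, 6}, {3, 1}, {3, 2}, {3, 5}, {3, 6}, {1, 2}, {5, 6}})"

lemma graph_graph_G: "n \<ge> 7 \<Longrightarrow> graph (graph_G n)"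
  unfolding graph_G_def by (rule graph_undirected) (auto simp: path_edges_def card_insert_if)

lemma graph_graph_H: "n \<ge> 7 \<Longrightarrow> graph (graph_H n)"
  unfolding graph_H_def by (rule graph_undirected) (auto simp: path_edges_def card_insert_if)

end

theory Submission
  imports Defs
begin

text \<open>
  Write \<open>P\<close> for the exponential distance matrix of the path \<open>7, \<dots>, n\<close>. Both matrices have an invariant
  subspace of codimension two on which they act as the same matrix
  \<open>diag(1/2, 1/2, 1/2, 1) \<oplus> P\<close>. The four scalars come from differences of twin vertices
  and of twin pairs. For \<open>H\<close> the copy of \<open>P\<close> is the path component. For \<open>G\<close> it is the image of the map
  \<open>X\<close> with entries \<open>2\<^bsup>-(w-p)\<^esup>\<close> for \<open>p < w\<close>, \<open>0\<close> for \<open>p = w\<close> and \<open>-2 \<cdot> 2\<^bsup>-(p-w)\<^esup>\<close> for \<open>p > w\<close>, which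
  intertwines \<open>P\<close> with the matrix of \<open>G\<close>. The remaining quotient is two-dimensional, so its
  characteristic polynomial is determined by the traces of the matrix and of its square, and these
  agree for \<open>G\<close> and \<open>H\<close>.
\<close>

subsection \<open>Matrices with a common compression of codimension two\<close>

definition mat_trace :: "'a::comm_monoid_add mat \<Rightarrow> 'a" where
  "mat_trace A = (\<Sum>i<dim_row A. A $$ (i, i))"

lemma mult_mat_index:
  assumes "A \<in> carrier_mat n k" "B \<in> carrier_mat k m" "i < n" "j < m"
  shows "(A * B) $$ (i, j) = (\<Sum>l<k. A $$ (i, l) * B $$ (l, j))"
  using assms by (auto simp: scalar_prod_def atLeast0LessThan intro!: sum.cong)

lemma mat_trace_mult:
  assumes "A \<in> carrier_mat n m" "B \<in> carrier_mat m n"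
  shows "mat_trace (A * B) = (\<Sum>i<n. \<Sum>l<m. A $$ (i, l) * B $$ (l, i))"
  using assms by (auto simp: mat_trace_def mult_mat_index simp del: index_mult_mat(1)
      intro!: sum.cong)

lemma mat_trace_mult_comm:
  fixes A :: "'a::comm_semiring_0 mat"
  assumes "A \<in> carrier_mat n m" "B \<in> carrier_mat m n"
  shows "mat_trace (A * B) = mat_trace (B * A)"
proof -
  have "mat_trace (A * B) = (\<Sum>l<m. \<Sum>i<n. A $$ (i, l) * B $$ (l, i))"
    using assms by (simp add: mat_trace_mult sum.swap[of _ "{..<m}"])
  then show ?thesis
    using assms by (simp add: mat_trace_mult mult.commute)
qed

lemma mat_trace_conjugate:
  fixes A :: "'a::comm_ring_1 mat"
  assumes "A \<in> carrier_mat n n" "P \<in> carrier_mat n n" "Q \<in> carrier_mat n n" "P * Q = 1\<^sub>m n"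
  shows "mat_trace (Q * A * P) = mat_trace A"
proof -
  have "mat_trace (Q * A * P) = mat_trace (P * (Q * A))"
    using assms by (intro mat_trace_mult_comm) auto
  also have "P * (Q * A) = A"
    using assms by (simp flip: assoc_mult_mat[of P n n Q n A n])
  finally show ?thesis .
qed

lemma det_mat_2:
  fixes A :: "'a::comm_ring_1 mat"
  assumes A: "A \<in> carrier_mat 2 2"
  shows "det A = A $$ (0, 0) * A $$ (1, 1) - A $$ (0, 1) * A $$ (1, 0)"
  using laplace_expansion_row[OF A, of 0] A
  by (simp add: numeral_2_eq_2 cofactor_def det_single mat_delete_def)

text \<open>The determinant is the second elementary symmetric function of the eigenvalues, so
  Newton's identity gives it as half of \<open>(tr A)^2 - tr (A * A)\<close>. In this form two
  traces fix the polynomial.\<close>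

lemma char_poly_mat_2:
  fixes A :: "'a::field_char_0 mat"
  assumes A: "A \<in> carrier_mat 2 2"
  shows "char_poly A =
    [:((mat_trace A)\<^sup>2 - mat_trace (A * A)) / 2, - mat_trace A, 1:]"
proof -
  have "char_poly A = [:A $$ (0, 0) * A $$ (1, 1) - A $$ (0, 1) * A $$ (1, 0),
      - (A $$ (0, 0) + A $$ (1, 1)), 1:]"
    unfolding char_poly_defs using A by (subst det_mat_2) (auto simp: algebra_simps)
  moreover have "mat_trace A = A $$ (0, 0) + A $$ (1, 1)"
    using A by (simp add: mat_trace_def numeral_2_eq_2)
  moreover have "mat_trace (A * A) = A $$ (0, 0) * A $$ (0, 0) + A $$ (1, 1) * A $$ (1, 1)
      + 2 * (A $$ (0, 1) * A $$ (1, 0))"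
    using A by (simp add: mat_trace_mult numeral_2_eq_2)
  ultimately show ?thesis
    by (simp add: power2_eq_square field_simps)
qed

text \<open>The characteristic matrix inherits the zero block, so its determinant is a
  product.\<close>

lemma char_poly_four_block_lower_left_zero:
  fixes A1 :: "'a::idom mat"
  assumes A1: "A1 \<in> carrier_mat n n" and A2: "A2 \<in> carrier_mat n m" and A4: "A4 \<in> carrier_mat m m"
  shows "char_poly (four_block_mat A1 A2 (0\<^sub>m m n) A4) = char_poly A1 * char_poly A4"
proof -
  have "char_poly_matrix (four_block_mat A1 A2 (0\<^sub>m m n) A4) =
      four_block_mat (char_poly_matrix A1) (map_mat (\<lambda>a. [:- a:]) A2) (0\<^sub>m m n) (char_poly_matrix A4)"
    unfolding char_poly_matrix_def
    by (rule eq_matI, insert A1 A2 A4, auto simp: one_poly_def)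
  moreover have "det \<dots> = det (char_poly_matrix A1) * det (char_poly_matrix A4)"
    using A1 A2 A4 by (intro det_four_block_mat_lower_left_zero) (auto simp: char_poly_matrix_def)
  ultimately show ?thesis
    by (simp add: char_poly_def)
qed

lemma sum_lessThan_add:
  fixes f :: "nat \<Rightarrow> 'a::comm_monoid_add"
  shows "(\<Sum>i<k + m. f i) = (\<Sum>i<k. f i) + (\<Sum>i<m. f (k + i))"
  by (induction m) (auto simp: add.assoc)

lemma mat_trace_four_block:
  assumes "A1 \<in> carrier_mat n n" "A2 \<in> carrier_mat n m" "A3 \<in> carrier_mat m n" "A4 \<in> carrier_mat m m"
  shows "mat_trace (four_block_mat A1 A2 A3 A4) = mat_trace A1 + mat_trace A4"
  using assms by (auto simp: mat_trace_def sum_lessThan_add)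

lemma mat_inverse_exists:
  fixes S :: "'a::field mat"
  assumes "S \<in> carrier_mat n n" "det S \<noteq> 0"
  obtains Q where "Q \<in> carrier_mat n n" "S * Q = 1\<^sub>m n" "Q * S = 1\<^sub>m n"
  using det_non_zero_imp_unit[OF assms, of "()"] that by (auto simp: Units_def ring_mat_def)

text \<open>By \<open>inv\<close> the first \<open>k\<close> columns of \<open>S\<close> span an
  invariant subspace on which \<open>A\<close> acts as \<open>C\<close>. In the basis
  \<open>S\<close> the matrix is therefore block upper triangular with diagonal blocks
  \<open>C\<close> and \<open>K\<close>, where \<open>K\<close> is the action on the
  quotient.\<close>

lemma invariant_subspace_block:
  fixes A :: "'a::field mat"
  assumes A: "A \<in> carrier_mat (k + m) (k + m)" and S: "S \<in> carrier_mat (k + m) (k + m)"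
    and C: "C \<in> carrier_mat k k" and det: "det S \<noteq> 0"
    and inv: "\<And>i j. i < k + m \<Longrightarrow> j < k \<Longrightarrow>
      (\<Sum>l<k + m. A $$ (i, l) * S $$ (l, j)) = (\<Sum>l<k. S $$ (i, l) * C $$ (l, j))"
  obtains K where "K \<in> carrier_mat m m"
    "char_poly A = char_poly C * char_poly K"
    "mat_trace A = mat_trace C + mat_trace K"
    "mat_trace (A * A) = mat_trace (C * C) + mat_trace (K * K)"
proof -
  let ?n = "k + m"
  obtain Q where Q: "Q \<in> carrier_mat ?n ?n" and SQ: "S * Q = 1\<^sub>m ?n" and QS: "Q * S = 1\<^sub>m ?n"
    using mat_inverse_exists[OF S det] .
  define N where "N = Q * A * S"
  have N: "N \<in> carrier_mat ?n ?n" using Q A S by (auto simp: N_def)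
  define B where "B = mat k m (\<lambda>(i, j). N $$ (i, k + j))"
  define K where "K = mat m m (\<lambda>(i, j). N $$ (k + i, k + j))"
  have B: "B \<in> carrier_mat k m" and K: "K \<in> carrier_mat m m" by (auto simp: B_def K_def)
  \<comment> \<open>The first \<open>k\<close> columns of \<open>A * S\<close> are those of
    \<open>S\<close> multiplied by \<open>C\<close>, and \<open>Q * S = 1\<close> turns them into
    \<open>C\<close> above zero rows.\<close>
  have left: "N $$ (i, j) = (if i < k then C $$ (i, j) else 0)" if "i < ?n" "j < k" for i j
  proof -
    have "N = Q * (A * S)" unfolding N_def using Q A S by simp
    then have "N $$ (i, j) = (\<Sum>l<?n. Q $$ (i, l) * (A * S) $$ (l, j))"
      using mult_mat_index[OF Q mult_carrier_mat[OF A S]] that by simp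
    also have "\<dots> = (\<Sum>l<?n. \<Sum>p<k. Q $$ (i, l) * (S $$ (l, p) * C $$ (p, j)))"
    proof (rule sum.cong[OF refl])
      fix l assume "l \<in> {..<?n}"
      then have "(A * S) $$ (l, j) = (\<Sum>p<k. S $$ (l, p) * C $$ (p, j))"
        using mult_mat_index[OF A S, of l j] inv[of l j] that by simp
      then show "Q $$ (i, l) * (A * S) $$ (l, j) =
          (\<Sum>p<k. Q $$ (i, l) * (S $$ (l, p) * C $$ (p, j)))"
        by (simp add: sum_distrib_left)
    qed
    also have "\<dots> = (\<Sum>p<k. \<Sum>l<?n. Q $$ (i, l) * (S $$ (l, p) * C $$ (p, j)))"
      by (rule sum.swap)
    also have "\<dots> = (\<Sum>p<k. (Q * S) $$ (i, p) * C $$ (p, j))"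
      by (rule sum.cong) (use mult_mat_index[OF Q S] that in \<open>auto simp: sum_distrib_right mult.assoc
          simp del: index_mult_mat(1)\<close>)
    also have "\<dots> = (\<Sum>p<k. if p = i then C $$ (p, j) else 0)"
      by (rule sum.cong) (use that in \<open>auto simp: QS\<close>)
    finally show ?thesis by simp
  qed
  have block: "N = four_block_mat C B (0\<^sub>m m k) K"
    by (rule eq_matI, insert N C B K, auto simp: left B_def K_def)
  have NN: "N * N = four_block_mat (C * C) (C * B + B * K) (0\<^sub>m m k) (K * K)"
    unfolding block using C B K
    by (subst mult_four_block_mat[of _ k k _ m _ m _ _ k _ m]) (auto)
  have "similar_mat A N"
  proof (rule similar_matI)
    show "{A, N, S, Q} \<subseteq> carrier_mat ?n ?n" using A N S Q by auto
    have "S * N * Q = (S * Q) * A * (S * Q)"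
      unfolding N_def using A S Q by (simp add: assoc_mult_mat[where ?n\<^sub>1 = ?n and ?n\<^sub>2 = ?n
            and ?n\<^sub>3 = ?n and ?n\<^sub>4 = ?n])
    then show "A = S * N * Q" using SQ A by simp
  qed fact+
  then have "char_poly A = char_poly N" by (rule char_poly_similar)
  then have "char_poly A = char_poly C * char_poly K"
    using char_poly_four_block_lower_left_zero[OF C B K] by (simp add: block)
  moreover have "mat_trace A = mat_trace C + mat_trace K"
    using mat_trace_conjugate[OF A S Q SQ] mat_trace_four_block[OF C B _ K]
    by (simp add: N_def[symmetric] block)
  moreover have "mat_trace (A * A) = mat_trace (C * C) + mat_trace (K * K)"
  proof -
    have "N * N = Q * A * (S * Q) * A * S"
      unfolding N_def using A S Q by (simp add: assoc_mult_mat[where ?n\<^sub>1 = ?n and ?n\<^sub>2 = ?n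
            and ?n\<^sub>3 = ?n and ?n\<^sub>4 = ?n])
    also have "\<dots> = Q * (A * A) * S"
      using SQ A Q S by simp
    finally have "mat_trace (A * A) = mat_trace (N * N)"
      using mat_trace_conjugate[OF _ S Q SQ, of "A * A"] A by simp
    then show ?thesis
      using NN mat_trace_four_block[of "C * C" k "C * B + B * K" m "0\<^sub>m m k" "K * K"] C B K by simp
  qed
  ultimately show thesis using that K by blast
qed

text \<open>Both polynomials share the factor of \<open>C\<close>. Subtracting the contributions of
  \<open>C\<close> shows that the two quotients, which are 2 by 2, agree in both traces, and
  \<open>char_poly_mat_2\<close> depends on nothing else.\<close>

lemma char_poly_eq_if_common_compression:
  fixes A :: "'a::field_char_0 mat"
  assumes A: "A \<in> carrier_mat (k + 2) (k + 2)" and S: "S \<in> carrier_mat (k + 2) (k + 2)"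
    and B: "B \<in> carrier_mat (k + 2) (k + 2)" and T: "T \<in> carrier_mat (k + 2) (k + 2)"
    and C: "C \<in> carrier_mat k k" and det: "det S \<noteq> 0" "det T \<noteq> 0"
    and invA: "\<And>i j. i < k + 2 \<Longrightarrow> j < k \<Longrightarrow>
      (\<Sum>l<k + 2. A $$ (i, l) * S $$ (l, j)) = (\<Sum>l<k. S $$ (i, l) * C $$ (l, j))"
    and invB: "\<And>i j. i < k + 2 \<Longrightarrow> j < k \<Longrightarrow>
      (\<Sum>l<k + 2. B $$ (i, l) * T $$ (l, j)) = (\<Sum>l<k. T $$ (i, l) * C $$ (l, j))"
    and trace: "mat_trace A = mat_trace B" and trace2: "mat_trace (A * A) = mat_trace (B * B)"
  shows "char_poly A = char_poly B"
proof -
  obtain K where K: "K \<in> carrier_mat 2 2" "char_poly A = char_poly C * char_poly K"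
    "mat_trace A = mat_trace C + mat_trace K"
    "mat_trace (A * A) = mat_trace (C * C) + mat_trace (K * K)"
    using invariant_subspace_block[OF A S C det(1) invA] by metis
  obtain L where L: "L \<in> carrier_mat 2 2" "char_poly B = char_poly C * char_poly L"
    "mat_trace B = mat_trace C + mat_trace L"
    "mat_trace (B * B) = mat_trace (C * C) + mat_trace (L * L)"
    using invariant_subspace_block[OF B T C det(2) invB] by metis
  have "mat_trace K = mat_trace L" "mat_trace (K * K) = mat_trace (L * L)"
    using K(3,4) L(3,4) trace trace2 by simp_all
  then have "char_poly K = char_poly L"
    by (simp add: char_poly_mat_2[OF K(1)] char_poly_mat_2[OF L(1)])
  then show ?thesis using K(2) L(2) by simp
qed

text \<open>Row \<open>a\<close> minus \<open>c\<close> times row \<open>b\<close> has its last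
  nonzero entry in column \<open>j\<close>. Applied to a kernel vector, it forces coordinate
  \<open>j\<close> to vanish once all earlier coordinates do. Taking \<open>c = 0\<close> covers a
  pivot in a single row.\<close>

lemma det_nonzero_if_row_pivots:
  fixes S :: "'a::field mat"
  assumes S: "S \<in> carrier_mat n n"
    and pivot: "\<And>j. j < n \<Longrightarrow> \<exists>a<n. \<exists>b<n. \<exists>c. S $$ (a, j) - c * S $$ (b, j) \<noteq> 0 \<and>
      (\<forall>l<n. j < l \<longrightarrow> S $$ (a, l) - c * S $$ (b, l) = 0)"
  shows "det S \<noteq> 0"
proof
  assume "det S = 0"
  then obtain v where v: "v \<in> carrier_vec n" "v \<noteq> 0\<^sub>v n" "S *\<^sub>v v = 0\<^sub>v n"
    using det_0_iff_vec_prod_zero[OF S] by blast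
  have row: "(\<Sum>l<n. S $$ (i, l) * v $ l) = 0" if "i < n" for i
  proof -
    have "(S *\<^sub>v v) $ i = (\<Sum>l<n. S $$ (i, l) * v $ l)"
      using S v(1) that by (auto simp: scalar_prod_def atLeast0LessThan intro!: sum.cong)
    then show ?thesis using v(3) that by simp
  qed
  have "v $ j = 0" if "j < n" for j
    using that
  proof (induction j rule: less_induct)
    case (less j)
    obtain a b c where ab: "a < n" "b < n" and y: "S $$ (a, j) - c * S $$ (b, j) \<noteq> 0"
      "\<forall>l<n. j < l \<longrightarrow> S $$ (a, l) - c * S $$ (b, l) = 0"
      using pivot[OF less.prems] by blast
    have "0 = (\<Sum>l<n. S $$ (a, l) * v $ l) - c * (\<Sum>l<n. S $$ (b, l) * v $ l)"
      using row ab by simp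
    also have "\<dots> = (\<Sum>l<n. (S $$ (a, l) - c * S $$ (b, l)) * v $ l)"
      by (simp add: sum_distrib_left left_diff_distrib sum_subtractf mult.assoc)
    \<comment> \<open>Terms left of \<open>j\<close> vanish by induction, terms right of
      \<open>j\<close> by the pivot condition.\<close>
    also have "\<dots> = (\<Sum>l<n. if l = j then (S $$ (a, l) - c * S $$ (b, l)) * v $ l else 0)"
    proof (rule sum.cong[OF refl])
      fix l assume "l \<in> {..<n}"
      then show "(S $$ (a, l) - c * S $$ (b, l)) * v $ l =
          (if l = j then (S $$ (a, l) - c * S $$ (b, l)) * v $ l else 0)"
        using less.IH[of l] y(2) by (cases l j rule: linorder_cases) auto
    qed
    also have "\<dots> = (S $$ (a, j) - c * S $$ (b, j)) * v $ j"
      using less.prems by simp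
    finally show ?case using y(1) by simp
  qed
  then show False using v(1,2) by auto
qed

subsection \<open>Shortest-path distances\<close>

lemma undirected_simps:
  "verts (undirected V E) = V" "arcs (undirected V E) = {(u, v). {u, v} \<in> E}"
  "tail (undirected V E) = fst" "head (undirected V E) = snd"
  by (simp_all add: undirected_def)

lemma wf_digraph_undirected:
  assumes "\<And>e. e \<in> E \<Longrightarrow> e \<subseteq> V"
  shows "wf_digraph (undirected V E)"
  using assms by unfold_locales (fastforce simp: undirected_simps)+

text \<open>A certificate for distances to \<open>v\<close>: since \<open>d\<close> drops by at most
  one along an edge, no path from \<open>u\<close> to \<open>v\<close> is shorter than
  \<open>d u\<close>, and descending neighbours supply a path of exactly that length. The set
  \<open>W\<close> is closed under adjacency, so it may be a single component.\<close>

lemma gdist_undirected_eq: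
  fixes d :: "'a \<Rightarrow> nat"
  assumes E: "\<And>e. e \<in> E \<Longrightarrow> e \<subseteq> V" and W: "W \<subseteq> V" and u: "u \<in> W" and v: "v \<in> W" and dv: "d v = 0"
    and step: "\<And>x y. {x, y} \<in> E \<Longrightarrow> x \<in> W \<Longrightarrow> y \<in> W \<and> d x \<le> d y + 1"
    and desc: "\<And>x. x \<in> W \<Longrightarrow> x \<noteq> v \<Longrightarrow> \<exists>y\<in>W. {x, y} \<in> E \<and> d x = d y + 1"
  shows "gdist (undirected V E) u v = enat (d u)"
proof -
  let ?G = "undirected V E"
  interpret wf_digraph ?G using E by (rule wf_digraph_undirected)
  have low: "d x \<le> length p" if "apath x p v" "x \<in> W" for x p
    using that
  proof (induction p arbitrary: x)
    case Nil
    then show ?case using dv by (simp add: apath_Nil_iff)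
  next
    case (Cons e p)
    then have "{x, snd e} \<in> E" "apath (snd e) p v"
      by (auto simp: apath_Cons_iff undirected_simps)
    then show ?case
      using Cons.IH[of "snd e"] step[of x "snd e"] Cons.prems(2) by force
  qed
  \<comment> \<open>\<open>gdist\<close> ranges over paths without repeated vertices. Bounding
    \<open>d\<close> on the visited vertices keeps a new start \<open>x\<close>, whose value is
    larger than all of theirs, off the path found from \<open>y\<close>.\<close>
  have ex: "\<exists>p. apath x p v \<and> length p = d x \<and> (\<forall>w \<in> set (awalk_verts x p). d w \<le> d x)"
    if "x \<in> W" "d x = k" for x k
    using that
  proof (induction k arbitrary: x)
    case 0
    then have "x = v" using desc[of x] by force
    then show ?case using v W
      by (intro exI[of _ "[]"]) (auto simp: apath_Nil_iff dv undirected_simps)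
  next
    case (Suc k)
    then have "x \<noteq> v" using dv by auto
    then obtain y where y: "y \<in> W" "{x, y} \<in> E" "d x = d y + 1"
      using desc Suc.prems by blast
    then obtain p where p: "apath y p v" "length p = d y"
      "\<forall>w \<in> set (awalk_verts y p). d w \<le> d y"
      using Suc.IH[of y] Suc.prems by auto
    then have "x \<notin> set (awalk_verts y p)" using y by force
    then show ?case using p y
      by (intro exI[of _ "(x, y) # p"]) (auto simp: apath_Cons_iff undirected_simps)
  qed
  from ex[OF u refl] obtain p where p: "apath u p v" "length p = d u" by blast
  show ?thesis
    unfolding gdist_def
  proof (rule antisym)
    show "(INF p \<in> {p. apath u p v}. enat (length p)) \<le> enat (d u)"
      using p by (metis (mono_tags, lifting) INF_lower mem_Collect_eq)
    show "enat (d u) \<le> (INF p \<in> {p. apath u p v}. enat (length p))"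
      using low u by (intro INF_greatest) auto
  qed
qed

text \<open>A path that starts in \<open>W\<close> stays in \<open>W\<close>, so the infimum
  defining \<open>gdist\<close> is over the empty set.\<close>

lemma gdist_undirected_eq_infinity:
  assumes E: "\<And>e. e \<in> E \<Longrightarrow> e \<subseteq> V" and u: "u \<in> W" and v: "v \<notin> W"
    and closed: "\<And>x y. {x, y} \<in> E \<Longrightarrow> x \<in> W \<Longrightarrow> y \<in> W"
  shows "gdist (undirected V E) u v = \<infinity>"
proof -
  interpret wf_digraph "undirected V E" using E by (rule wf_digraph_undirected)
  have "\<not> apath x p v" if "x \<in> W" for x p
    using that
  proof (induction p arbitrary: x)
    case Nil
    then show ?case using v by (auto simp: apath_Nil_iff)
  next
    case (Cons e p)
    then show ?case using closed
      by (cases e) (auto simp: apath_Cons_iff undirected_simps)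
  qed
  then show ?thesis using u by (simp add: gdist_def top_enat_def)
qed

text \<open>The sorted vertex list is \<open>1, ..., n\<close>, so row \<open>i\<close> belongs to
  vertex \<open>Suc i\<close>; this shift recurs below.\<close>

lemma exp_dist_matrix_undirected:
  "exp_dist_matrix q (undirected {1..n} E) =
    mat n n (\<lambda>(i, j). pow_enat q (gdist (undirected {1..n} E) (Suc i) (Suc j)))"
proof -
  have "sorted_list_of_set {1..n} = [1..<Suc n]"
    by (metis atLeastLessThanSuc_atLeastAtMost sorted_list_of_set_range)
  then show ?thesis
    by (auto simp: exp_dist_matrix_def undirected_def Let_def simp del: upt_Suc intro!: eq_matI)
qed

subsection \<open>The two graphs\<close>

definition edges_G :: "nat \<Rightarrow> nat set set" where
  "edges_G n = path_edges n \<union>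
     {{7, 3}, {7, 4}, {7, 5}, {7, 6}, {3, 4}, {5, 6}} \<union>
     {{n, 1}, {n, 2}, {1, 2}}"

definition edges_H :: "nat \<Rightarrow> nat set set" where
  "edges_H n = path_edges n \<union>
     {{4, 1}, {4, 2}, {4, 3}, {4, 5}, {4, 6}, {3, 1}, {3, 2}, {3, 5}, {3, 6}, {1, 2}, {5, 6}}"

text \<open>With truncated subtraction at most one summand is nonzero: this is the absolute
  difference.\<close>

definition ndist :: "nat \<Rightarrow> nat \<Rightarrow> nat" where
  "ndist a b = (a - b) + (b - a)"

text \<open>
  Position of a vertex of \<open>G\<close> along the path, prolonged by one place at either end: the vertices
  \<open>3, \<dots>, 6\<close> sit at \<open>6\<close> and the vertices \<open>1, 2\<close> at \<open>n + 1\<close>.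
\<close>

definition pos :: "nat \<Rightarrow> nat \<Rightarrow> nat" where
  "pos n v = (if v \<le> 2 then n + 1 else if v \<le> 6 then 6 else v)"

text \<open>The relevant classes are \<open>{1, 2}\<close>, \<open>{3, 4}\<close> and
  \<open>{5, 6}\<close>. In both graphs the two members of such a class are adjacent and have the
  same closed neighbourhood.\<close>

definition twins :: "nat \<Rightarrow> nat \<Rightarrow> bool" where
  "twins u v \<longleftrightarrow> (u + 1) div 2 = (v + 1) div 2"

lemma twins_sym: "twins u v \<longleftrightarrow> twins v u"
  and twins_trans: "twins u v \<Longrightarrow> twins v w \<Longrightarrow> twins u w"
  by (auto simp: twins_def)

lemma twins_le_2: "1 \<le> u \<Longrightarrow> u \<le> 2 \<Longrightarrow> 1 \<le> v \<Longrightarrow> v \<le> 2 \<Longrightarrow> twins u v"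
  unfolding twins_def by presburger

text \<open>The pairs \<open>{3, 4}\<close> and \<open>{5, 6}\<close> share a place but are linked
  only through vertex 7, whence the distance 2.\<close>

definition dist_G :: "nat \<Rightarrow> nat \<Rightarrow> nat \<Rightarrow> nat" where
  "dist_G n u v =
    (if u = v then 0
     else if pos n u = pos n v then (if twins u v then 1 else 2)
     else ndist (pos n u) (pos n v))"

text \<open>Vertices 3 and 4 are adjacent to all others among \<open>1, ..., 6\<close>, so
  nonadjacent vertices are at distance 2.\<close>

definition dist_H6 :: "nat \<Rightarrow> nat \<Rightarrow> nat" where
  "dist_H6 u v =
    (if u = v then 0
     else if u \<in> {3, 4} \<or> v \<in> {3, 4} \<or> twins u v then 1 else 2)"

lemma in_1_6_cases:
  assumes "1 \<le> (v::nat)" "v \<le> 6"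
  obtains "v = 1" | "v = 2" | "v = 3" | "v = 4" | "v = 5" | "v = 6"
  using assms by linarith

lemma edges_G_subset: "n \<ge> 7 \<Longrightarrow> e \<in> edges_G n \<Longrightarrow> e \<subseteq> {1..n}"
  by (auto simp: edges_G_def path_edges_def)

lemma edges_H_subset: "n \<ge> 7 \<Longrightarrow> e \<in> edges_H n \<Longrightarrow> e \<subseteq> {1..n}"
  by (auto simp: edges_H_def path_edges_def)

lemma ndist_triangle: "ndist a c \<le> ndist a b + ndist b c"
  unfolding ndist_def by linarith

lemma ndist_eq_0_iff: "ndist a b = 0 \<longleftrightarrow> a = b"
  by (auto simp: ndist_def)

lemma ndist_eq_1_iff: "ndist a b = 1 \<longleftrightarrow> b = a + 1 \<or> a = b + 1"
  unfolding ndist_def by linarith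

lemma path_edges_iff: "{x, y} \<in> path_edges n \<longleftrightarrow> x \<in> {7..n} \<and> y \<in> {7..n} \<and> ndist x y = 1"
  unfolding ndist_eq_1_iff path_edges_def doubleton_eq_iff mem_Collect_eq
  by (auto; linarith?)

text \<open>Reads adjacency off the places \<open>pos n x\<close> and \<open>pos n y\<close>, so
  that the distance proof reduces to the triangle inequality for \<open>ndist\<close>.\<close>

lemma edges_G_iff:
  assumes "n \<ge> 7"
  shows "{x, y} \<in> edges_G n \<longleftrightarrow> x \<in> {1..n} \<and> y \<in> {1..n} \<and>
    (ndist (pos n x) (pos n y) = 1 \<or> x \<noteq> y \<and> pos n x = pos n y \<and> twins x y)"
    (is "_ \<longleftrightarrow> ?R")
proof
  assume "{x, y} \<in> edges_G n"
  then show ?R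
    unfolding edges_G_def Un_iff insert_iff empty_iff path_edges_iff doubleton_eq_iff
    using assms by (elim disjE conjE) (simp_all add: pos_def ndist_def twins_def)
next
  assume R: ?R
  consider "x \<le> 6" "y \<le> 6" | "x \<le> 6" "y > 6" | "x > 6" "y \<le> 6" | "x > 6" "y > 6" by linarith
  then show "{x, y} \<in> edges_G n"
  proof cases
    case 1
    then have "1 \<le> x" "x \<le> 6" "1 \<le> y" "y \<le> 6" using R by auto
    then show ?thesis using R assms
      by (elim in_1_6_cases) (simp_all add: edges_G_def pos_def ndist_def twins_def insert_commute)
  next
    case 2
    then have x: "1 \<le> x" "x \<le> 6" using R by auto
    then have "if x \<le> 2 then y = n else y = 7"
      using R 2 by (auto simp: pos_def ndist_def split: if_splits)
    with x show ?thesis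
      by (elim in_1_6_cases) (simp_all add: edges_G_def insert_commute)
  next
    case 3
    then have y: "1 \<le> y" "y \<le> 6" using R by auto
    then have "if y \<le> 2 then x = n else x = 7"
      using R 3 by (auto simp: pos_def ndist_def split: if_splits)
    with y show ?thesis
      by (elim in_1_6_cases) (simp_all add: edges_G_def insert_commute)
  next
    case 4
    then have "{x, y} \<in> path_edges n" using R by (auto simp: path_edges_iff pos_def)
    then show ?thesis by (simp add: edges_G_def)
  qed
qed

lemma gdist_G:
  assumes n: "n \<ge> 7" and u: "u \<in> {1..n}" and v: "v \<in> {1..n}"
  shows "gdist (undirected {1..n} (edges_G n)) u v = enat (dist_G n u v)"
proof (rule gdist_undirected_eq[where d = "\<lambda>x. dist_G n x v" and W = "{1..n}"])
  fix x y assume e: "{x, y} \<in> edges_G n" "x \<in> {1..n}"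
  then have xy: "y \<in> {1..n}" "ndist (pos n x) (pos n y) = 1 \<or>
      x \<noteq> y \<and> pos n x = pos n y \<and> twins x y"
    by (auto simp: edges_G_iff[OF n])
  have "dist_G n x v \<le> dist_G n y v + 1"
    using xy(2) ndist_triangle[of "pos n x" "pos n v" "pos n y"]
      ndist_eq_0_iff[of "pos n y" "pos n v"]
    by (auto simp: dist_G_def twins_sym dest: twins_trans split: if_splits)
  with xy show "y \<in> {1..n} \<and> dist_G n x v \<le> dist_G n y v + 1" by simp
next
  fix x assume x: "x \<in> {1..n}" "x \<noteq> v"
  show "\<exists>y\<in>{1..n}. {x, y} \<in> edges_G n \<and> dist_G n x v = dist_G n y v + 1"
  proof (cases "dist_G n x v = 1")
    case True
    then have "pos n x = pos n v \<longrightarrow> twins x v" "pos n x \<noteq> pos n v \<longrightarrow> ndist (pos n x) (pos n v) = 1"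
      using x(2) by (auto simp: dist_G_def split: if_splits)
    then have "{x, v} \<in> edges_G n"
      using x v unfolding edges_G_iff[OF n] by blast
    then show ?thesis using True v by (intro bexI[of _ v]) (simp_all add: dist_G_def)
  next
    case False
    show ?thesis
    proof (cases "pos n x = pos n v")
      case True
      then have *: "3 \<le> x" "x \<le> 6" "3 \<le> v" "v \<le> 6" "dist_G n x v = 2"
        using False x v n twins_le_2[of x v] by (simp_all add: dist_G_def pos_def split: if_splits)
      \<comment> \<open>One of \<open>x\<close>, \<open>v\<close> lies in \<open>{3, 4}\<close> and
        the other in \<open>{5, 6}\<close>; their common neighbour is 7.\<close>
      then show ?thesis using n x
        by (intro bexI[of _ 7]) (simp_all add: edges_G_iff[OF n] dist_G_def pos_def ndist_def)
    next
      case neq: False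
      \<comment> \<open>One place from \<open>x\<close> towards \<open>v\<close>. It lies strictly
        between two places of the range \<open>6, ..., n + 1\<close>, hence it is a path vertex and
        its own place.\<close>
      define y where "y = (if pos n x < pos n v then pos n x + 1 else pos n x - 1)"
      have far: "ndist (pos n x) (pos n v) \<noteq> 1"
        using neq False x(2) by (auto simp: dist_G_def)
      have range: "pos n x \<in> {6..n + 1}" "pos n v \<in> {6..n + 1}"
        using x v n by (auto simp: pos_def)
      have y: "7 \<le> y" "y \<le> n" "ndist (pos n x) y = 1"
        "ndist (pos n x) (pos n v) = ndist y (pos n v) + 1" "y \<noteq> pos n v"
      proof -
        consider "pos n x + 1 < pos n v" | "pos n v + 1 < pos n x"
          using neq far unfolding ndist_eq_1_iff by linarith
        then have "7 \<le> y \<and> y \<le> n \<and> ndist (pos n x) y = 1 \<and>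
            ndist (pos n x) (pos n v) = ndist y (pos n v) + 1 \<and> y \<noteq> pos n v"
          using range by cases (simp_all add: y_def ndist_def, linarith)
        then show "7 \<le> y" "y \<le> n" "ndist (pos n x) y = 1"
          "ndist (pos n x) (pos n v) = ndist y (pos n v) + 1" "y \<noteq> pos n v" by auto
      qed
      then have py: "pos n y = y" by (simp add: pos_def)
      then have "y \<noteq> v" using y(5) by auto
      then show ?thesis using y py x neq
        by (intro bexI[of _ y]) (simp_all add: edges_G_iff[OF n] dist_G_def)
    qed
  qed
qed (use edges_G_subset[OF n] u v in \<open>auto simp: dist_G_def\<close>)

lemma edges_H_iff:
  assumes "n \<ge> 7"
  shows "{x, y} \<in> edges_H n \<longleftrightarrow> x \<in> {7..n} \<and> y \<in> {7..n} \<and> ndist x y = 1 \<or>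
    x \<in> {1..6} \<and> y \<in> {1..6} \<and> dist_H6 x y = 1"
    (is "_ \<longleftrightarrow> ?R")
proof
  assume "{x, y} \<in> edges_H n"
  then show ?R
    unfolding edges_H_def Un_iff insert_iff empty_iff path_edges_iff doubleton_eq_iff
    by (elim disjE conjE) (simp_all add: dist_H6_def twins_def)
next
  assume ?R
  then show "{x, y} \<in> edges_H n"
  proof
    assume "x \<in> {1..6} \<and> y \<in> {1..6} \<and> dist_H6 x y = 1"
    then have "1 \<le> x" "x \<le> 6" "1 \<le> y" "y \<le> 6" "dist_H6 x y = 1" by auto
    then show ?thesis
      by (elim in_1_6_cases) (simp_all add: edges_H_def dist_H6_def twins_def insert_commute)
  qed (simp add: edges_H_def path_edges_iff)
qed

lemma gdist_H_small:
  assumes n: "n \<ge> 7" and u: "u \<in> {1..6}" and v: "v \<in> {1..6}"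
  shows "gdist (undirected {1..n} (edges_H n)) u v = enat (dist_H6 u v)"
proof (rule gdist_undirected_eq[where d = "\<lambda>x. dist_H6 x v" and W = "{1..6}"])
  fix x y assume e: "{x, y} \<in> edges_H n" "x \<in> {1..6}"
  then have "y \<in> {1..6}" "dist_H6 x y = 1" by (auto simp: edges_H_iff[OF n])
  then show "y \<in> {1..6} \<and> dist_H6 x v \<le> dist_H6 y v + 1"
    \<comment> \<open>For \<open>y = v\<close> the edge itself gives distance 1. Otherwise
      \<open>dist_H6 y v\<close> is at least 1, and \<open>dist_H6\<close> never exceeds 2.\<close>
    by (cases "y = v") (auto simp: dist_H6_def)
next
  fix x assume x: "x \<in> {1..6}" "x \<noteq> v"
  show "\<exists>y\<in>{1..6}. {x, y} \<in> edges_H n \<and> dist_H6 x v = dist_H6 y v + 1"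
  proof (cases "dist_H6 x v = 1")
    case True
    then show ?thesis using x v
      by (intro bexI[of _ v]) (auto simp: edges_H_iff[OF n] dist_H6_def)
  next
    case False
    then have "dist_H6 x v = 2" "dist_H6 x 3 = 1" "dist_H6 3 v = 1"
      using x by (auto simp: dist_H6_def split: if_splits)
    \<comment> \<open>Vertex 3 is a common neighbour of any two nonadjacent vertices here.\<close>
    then show ?thesis using x by (intro bexI[of _ 3]) (auto simp: edges_H_iff[OF n])
  qed
qed (use edges_H_subset[OF n] u v n in \<open>auto simp: dist_H6_def\<close>)

lemma gdist_H_path:
  assumes n: "n \<ge> 7" and u: "u \<in> {7..n}" and v: "v \<in> {7..n}"
  shows "gdist (undirected {1..n} (edges_H n)) u v = enat (ndist u v)"
proof (rule gdist_undirected_eq[where d = "\<lambda>x. ndist x v" and W = "{7..n}"])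
  fix x y assume e: "{x, y} \<in> edges_H n" "x \<in> {7..n}"
  then show "y \<in> {7..n} \<and> ndist x v \<le> ndist y v + 1"
    by (auto simp: edges_H_iff[OF n] ndist_def)
next
  fix x assume x: "x \<in> {7..n}" "x \<noteq> v"
  then show "\<exists>y\<in>{7..n}. {x, y} \<in> edges_H n \<and> ndist x v = ndist y v + 1"
    using v by (intro bexI[of _ "if x < v then x + 1 else x - 1"])
      (auto simp: edges_H_iff[OF n] ndist_def)
qed (use edges_H_subset[OF n] u v n in \<open>auto simp: ndist_def\<close>)

lemma gdist_H_infinity:
  assumes n: "n \<ge> 7" and uv: "u \<in> {1..6} \<and> v \<in> {7..n} \<or> u \<in> {7..n} \<and> v \<in> {1..6}"
  shows "gdist (undirected {1..n} (edges_H n)) u v = \<infinity>"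
  using uv
proof
  assume "u \<in> {1..6} \<and> v \<in> {7..n}"
  then show ?thesis
    by (intro gdist_undirected_eq_infinity[where W = "{1..6}"] edges_H_subset[OF n])
      (auto simp: edges_H_iff[OF n])
next
  assume "u \<in> {7..n} \<and> v \<in> {1..6}"
  then show ?thesis
    by (intro gdist_undirected_eq_infinity[where W = "{7..n}"] edges_H_subset[OF n])
      (auto simp: edges_H_iff[OF n])
qed

section \<open>Closed forms for the entries of both matrices\<close>

definition entry_G :: "nat \<Rightarrow> nat \<Rightarrow> nat \<Rightarrow> real" where
  "entry_G n u v = (1 / 2) ^ dist_G n u v"

definition entry_H :: "nat \<Rightarrow> nat \<Rightarrow> real" where
  "entry_H u v =
    (if u \<le> 6 \<and> v \<le> 6 then (1 / 2) ^ dist_H6 u v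
     else if u > 6 \<and> v > 6 then (1 / 2) ^ ndist u v else 0)"

lemma exp_dist_matrix_G:
  assumes "n \<ge> 7"
  shows "exp_dist_matrix (1 / 2) (graph_G n) = mat n n (\<lambda>(i, j). entry_G n (Suc i) (Suc j))"
  unfolding graph_G_def edges_G_def[symmetric] exp_dist_matrix_undirected
  using assms by (intro cong_mat refl) (simp add: gdist_G pow_enat_def entry_G_def del: One_nat_def)

lemma exp_dist_matrix_H:
  assumes n: "n \<ge> 7"
  shows "exp_dist_matrix (1 / 2) (graph_H n) = mat n n (\<lambda>(i, j). entry_H (Suc i) (Suc j))"
  unfolding graph_H_def edges_H_def[symmetric] exp_dist_matrix_undirected
proof (intro cong_mat refl, clarify)
  fix i j assume ij: "i < n" "j < n"
  then consider "Suc i \<in> {1..6}" "Suc j \<in> {1..6}" | "Suc i \<in> {7..n}" "Suc j \<in> {7..n}"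
    | "Suc i \<in> {1..6} \<and> Suc j \<in> {7..n} \<or> Suc i \<in> {7..n} \<and> Suc j \<in> {1..6}"
    by fastforce
  then show "pow_enat (1 / 2) (gdist (undirected {1..n} (edges_H n)) (Suc i) (Suc j)) =
      entry_H (Suc i) (Suc j)"
  proof cases
    case 1
    then show ?thesis by (subst gdist_H_small[OF n]) (auto simp: entry_H_def pow_enat_def)
  next
    case 2
    then show ?thesis by (subst gdist_H_path[OF n]) (auto simp: entry_H_def pow_enat_def)
  next
    case 3
    then show ?thesis by (subst gdist_H_infinity[OF n]) (auto simp: entry_H_def pow_enat_def)
  qed
qed

subsection \<open>Invariant subspaces\<close>

text \<open>
  If \<open>f\<close> is an eigenvector of the path matrix for \<open>\<lambda>\<close>, then solving the three-term recurrence for \<open>G\<close>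
  with the boundary condition at \<open>3, \<dots>, 6\<close> gives, after multiplication by \<open>\<lambda> - 1\<close>, the
  vector \<open>\<Sum>w. path_twist p w * f w\<close>. The formula no longer involves \<open>\<lambda>\<close>.
\<close>

definition path_twist :: "nat \<Rightarrow> nat \<Rightarrow> real" where
  "path_twist p w =
    (if p < w then (1 / 2) ^ (w - p) else if p = w then 0 else - 2 * (1 / 2) ^ (p - w))"

text \<open>
  An antidifference in \<open>k\<close> of the terms of the commutator of \<open>path_twist\<close> with the path matrix.
\<close>

definition path_potential :: "nat \<Rightarrow> nat \<Rightarrow> nat \<Rightarrow> real" where
  "path_potential p j k =
    (if k \<le> p \<and> k \<le> j then (1 / 2) ^ ((p - k) + (j - k))
     else if p < k \<and> j < k then 4 * (1 / 2) ^ ((k - p) + (k - j))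
     else if p < k then 2 * (1 / 2) ^ (j - p) else 3 * (1 / 2) ^ (p - j))"

text \<open>The order of \<open>k\<close> relative to \<open>p\<close> and to \<open>j\<close> gives
  nine cases. Writing the gaps as successors removes the truncated subtractions, and each case
  compares multiples of one power of 1/2. When \<open>k\<close> is strictly between \<open>p\<close>
  and \<open>j\<close> both sides are 0.\<close>

lemma path_potential_step:
  "path_potential p j (Suc k) - path_potential p j k =
    (1 / 2) ^ ndist p k * path_twist k j - path_twist p k * (1 / 2) ^ ndist k j"
proof -
  consider (1) a b where "p = Suc (k + a)" "j = Suc (k + b)" | (2) a where "p = Suc (k + a)" "j = k"
    | (3) a b where "p = Suc (k + a)" "k = Suc (j + b)"
    | (4) b where "p = k" "j = Suc (k + b)" | (5) "p = k" "j = k" | (6) b where "p = k" "k = Suc (j + b)"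
    | (7) a b where "k = Suc (p + a)" "j = Suc (k + b)" | (8) a where "k = Suc (p + a)" "j = k"
    | (9) a b where "k = Suc (p + a)" "k = Suc (j + b)"
    by (metis less_imp_Suc_add linorder_neqE_nat)
  then show ?thesis
  proof cases
    case 9
    \<comment> \<open>Both equations determine \<open>k\<close>, so eliminating it leaves a
      truncated subtraction for \<open>j\<close>; the differences that occur are therefore computed
      by hand.\<close>
    have "j = p + a - b" "b \<le> p + a" using 9 by linarith+
    moreover have "Suc (Suc (p + a)) - j = Suc (Suc b)" "Suc (p + a) - j = Suc b" using 9 by linarith+
    ultimately show ?thesis using 9
      by (simp add: path_potential_def path_twist_def ndist_def power_add)
  qed (simp_all add: path_potential_def path_twist_def ndist_def power_add)
qed

text \<open>The potential telescopes: on an interval the path matrix commutes with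
  \<open>path_twist\<close> up to two boundary values. In \<open>G\<close> the vertices
  \<open>1, ..., 6\<close> cancel these. The place \<open>p\<close> may lie outside the interval, as
  it does for those vertices.\<close>

lemma path_twist_commutator:
  assumes "a \<le> Suc b"
  shows "(\<Sum>w = a..b. (1 / 2) ^ ndist p w * path_twist w j)
    = (\<Sum>w = a..b. path_twist p w * (1 / 2) ^ ndist w j)
      + (path_potential p j (Suc b) - path_potential p j a)"
proof -
  have "(\<Sum>w = a..b. path_potential p j (Suc w) - path_potential p j w) =
      path_potential p j (Suc b) - path_potential p j a"
    using assms by (rule sum_Suc_diff)
  then show ?thesis
    by (simp add: path_potential_step sum_subtractf)
qed

lemma sum_1_6:
  fixes f :: "nat \<Rightarrow> 'a::comm_monoid_add"
  shows "(\<Sum>v = 1..6. f v) = f 1 + (f 2 + (f 3 + (f 4 + (f 5 + f 6))))"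
proof -
  have "{1..6} = {1, 2, 3, 4, 5, 6 :: nat}" by auto
  then show ?thesis by simp
qed

lemma sum_vertices_split:
  fixes f :: "nat \<Rightarrow> 'a::comm_monoid_add"
  assumes "n \<ge> 7"
  shows "(\<Sum>i<n. f (Suc i)) = (\<Sum>v = 1..6. f v) + (\<Sum>w = 7..n. f w)"
proof -
  have "(\<Sum>i<n. f (Suc i)) = (\<Sum>w = 1..n. f w)"
    by (simp add: sum.atLeast1_atMost_eq)
  also have "{1..n} = {1..6} \<union> {7..n}" using assms by auto
  also have "(\<Sum>w \<in> \<dots>. f w) = (\<Sum>v = 1..6. f v) + (\<Sum>w = 7..n. f w)"
    by (rule sum.union_disjoint) auto
  finally show ?thesis .
qed

lemma sum_columns_split:
  fixes f :: "nat \<Rightarrow> 'a::comm_monoid_add"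
  assumes "n \<ge> 7"
  shows "(\<Sum>l<n - 2. f l) = (\<Sum>l<4. f l) + (\<Sum>w = 7..n. f (w - 3))"
proof -
  have "(\<Sum>l<n - 2. f l) = (\<Sum>l<4 + (n - 6). f l)"
    using assms by (intro sum.cong) auto
  also have "\<dots> = (\<Sum>l<4. f l) + (\<Sum>l<n - 6. f (4 + l))"
    by (rule sum_lessThan_add)
  also have "(\<Sum>l<n - 6. f (4 + l)) = (\<Sum>w = 7..n. f (w - 3))"
    by (rule sum.reindex_bij_witness[of _ "\<lambda>w. w - 7" "\<lambda>l. l + 7"]) (use assms in auto)
  finally show ?thesis .
qed

text \<open>
  Column \<open>j \<ge> 4\<close> of either basis corresponds to position \<open>j + 3\<close>. The last two columns of each
  only complete the others to a basis.
\<close>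

definition basis_G :: "nat \<Rightarrow> nat \<Rightarrow> nat \<Rightarrow> real" where
  "basis_G n v j =
    (if j = 0 then of_bool (v = 1) - of_bool (v = 2)
     else if j = 1 then of_bool (v = 3) - of_bool (v = 4)
     else if j = 2 then of_bool (v = 5) - of_bool (v = 6)
     else if j = 3 then of_bool (v = 3 \<or> v = 4) - of_bool (v = 5 \<or> v = 6)
     else path_twist (pos n v) (j + 3))"

definition basis_H :: "nat \<Rightarrow> nat \<Rightarrow> nat \<Rightarrow> real" where
  "basis_H n v j =
    (if j = 0 then of_bool (v = 1) - of_bool (v = 2)
     else if j = 1 then of_bool (v = 5) - of_bool (v = 6)
     else if j = 2 then of_bool (v = 3) - of_bool (v = 4)
     else if j = 3 then of_bool (v = 1 \<or> v = 2) - of_bool (v = 5 \<or> v = 6)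
     else if j < n - 2 then of_bool (v = j + 3)
     else if j = n - 2 then of_bool (v = 1 \<or> v = 2)
     else of_bool (v = 3 \<or> v = 4))"

text \<open>A difference of twins has eigenvalue \<open>1 - 1/2\<close>. A difference of two twin
  pairs at distance 2 has \<open>1 + 1/2 - 2 * 1/4 = 1\<close>; these pairs are
  \<open>{3, 4}\<close>, \<open>{5, 6}\<close> in \<open>G\<close> and \<open>{1, 2}\<close>,
  \<open>{5, 6}\<close> in \<open>H\<close>. The shift by 3 between columns and positions cancels in
  \<open>ndist\<close>.\<close>

definition compression :: "nat \<Rightarrow> nat \<Rightarrow> real" where
  "compression l j =
    (if l < 4 \<or> j < 4 then (if l = j then (if j = 3 then 1 else 1 / 2) else 0)
     else (1 / 2) ^ ndist l j)"

lemma vertex_cases: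
  assumes "1 \<le> (v::nat)"
  obtains "v = 1" | "v = 2" | "v = 3" | "v = 4" | "v = 5" | "v = 6" | "v \<ge> 7"
  using assms by linarith

lemma entry_G_path: "v \<ge> 7 \<Longrightarrow> v \<le> n \<Longrightarrow> entry_G n u v = (1 / 2) ^ ndist (pos n u) v"
  by (auto simp: entry_G_def dist_G_def twins_def pos_def ndist_def)

text \<open>The first four columns are eigenvectors supported on \<open>1, ..., 6\<close>. For the
  others, path vertices contribute the commutator of \<open>path_twist\<close> with the path matrix,
  and the remaining vertices cancel its boundary values.\<close>

lemma invariant_G:
  assumes n: "n \<ge> 7" and u: "u \<in> {1..n}" and j: "j < n - 2"
  shows "(\<Sum>l<n. entry_G n u (Suc l) * basis_G n (Suc l) j) =
    (\<Sum>l<n - 2. basis_G n u l * compression l j)"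
proof (cases "j < 4")
  case True
  have L: "(\<Sum>w = 7..n. entry_G n u w * basis_G n w j) = 0"
    using True by (intro sum.neutral) (auto simp: basis_G_def)
  have "(\<Sum>l<n - 2. basis_G n u l * compression l j) =
      (\<Sum>l<n - 2. if l = j then basis_G n u j * (if j = 3 then 1 else 1 / 2) else 0)"
    using True by (intro sum.cong) (auto simp: compression_def)
  also have "\<dots> = basis_G n u j * (if j = 3 then 1 else 1 / 2)"
    using j by simp
  finally have R: "(\<Sum>l<n - 2. basis_G n u l * compression l j) =
      basis_G n u j * (if j = 3 then 1 else 1 / 2)" .
  have j': "j = 0 \<or> j = 1 \<or> j = 2 \<or> j = 3" using True by linarith
  have "1 \<le> u" using u by simp
  then show ?thesis
    unfolding sum_vertices_split[OF n, of "\<lambda>v. entry_G n u v * basis_G n v j"] L R sum_1_6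
    using j' n by (elim vertex_cases disjE) (simp_all add: basis_G_def entry_G_def dist_G_def pos_def twins_def power2_eq_square)
next
  case False
  define w0 where "w0 = j + 3"
  have w0: "7 \<le> w0" "w0 \<le> n" using False j by (auto simp: w0_def)
  let ?p = "pos n u"
  have L: "(\<Sum>w = 7..n. entry_G n u w * basis_G n w j) =
      (\<Sum>w = 7..n. (1 / 2) ^ ndist ?p w * path_twist w w0)"
    using False by (intro sum.cong) (auto simp: entry_G_path basis_G_def pos_def w0_def)
  have "(\<Sum>l<n - 2. basis_G n u l * compression l j) =
      (\<Sum>w = 7..n. basis_G n u (w - 3) * compression (w - 3) j)"
    using sum_columns_split[OF n, of "\<lambda>l. basis_G n u l * compression l j"] False
    by (simp add: compression_def)
  also have "\<dots> = (\<Sum>w = 7..n. path_twist ?p w * (1 / 2) ^ ndist w w0)"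
    using False by (intro sum.cong) (auto simp: compression_def basis_G_def w0_def ndist_def add.commute)
  finally have R: "(\<Sum>l<n - 2. basis_G n u l * compression l j) = \<dots>" .
  have C: "(\<Sum>w = 7..n. (1 / 2) ^ ndist ?p w * path_twist w w0) =
      (\<Sum>w = 7..n. path_twist ?p w * (1 / 2) ^ ndist w w0)
      + (path_potential ?p w0 (Suc n) - path_potential ?p w0 7)"
    using n by (intro path_twist_commutator) simp
  \<comment> \<open>Up to constants, \<open>r\<close> and \<open>s\<close> are the values of column
    \<open>j\<close> at the two prolonged ends: \<open>- r\<close> at vertices 1, 2 and
    \<open>s / 2\<close> at vertices 3 to 6.\<close>
  define r where "r = (1 / 2 :: real) ^ (n - w0)"
  define s where "s = (1 / 2 :: real) ^ (w0 - 7)"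
  have "Suc n - w0 = Suc (n - w0)" "w0 - 6 = Suc (w0 - 7)" using w0 by auto
  then have rs: "(1 / 2 :: real) ^ (Suc n - w0) = r / 2" "(1 / 2 :: real) ^ (w0 - 6) = s / 2"
    by (simp_all add: r_def s_def)
  have basis: "basis_G n v j = (if v \<le> 2 then - r else s / 2)" if "v \<le> 6" for v
    using that False w0 rs by (simp add: basis_G_def pos_def path_twist_def flip: w0_def)
  \<comment> \<open>The pair at place \<open>n + 1\<close> cancels the boundary value at
    \<open>Suc n\<close>, and the four vertices at place 6 cancel the one at 7. The row
    \<open>u\<close> may be on the path or at either end.\<close>
  have "(\<Sum>v = 1..6. entry_G n u v * basis_G n v j)
      + (path_potential ?p w0 (Suc n) - path_potential ?p w0 7) = 0"
  proof (cases "u \<ge> 7")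
    case True
    define x where "x = (1 / 2 :: real) ^ (n - u)"
    define y where "y = (1 / 2 :: real) ^ (u - 7)"
    have "Suc n - u = Suc (n - u)" "u - 6 = Suc (u - 7)" using True u by auto
    then have xy: "(1 / 2 :: real) ^ (Suc n - u) = x / 2" "(1 / 2 :: real) ^ (u - 6) = y / 2"
      by (simp_all add: x_def y_def)
    have "path_potential ?p w0 (Suc n) = 4 * ((1 / 2) ^ (Suc n - u) * (1 / 2) ^ (Suc n - w0))"
      "path_potential ?p w0 7 = (1 / 2) ^ (u - 7) * (1 / 2) ^ (w0 - 7)"
      using True u w0 unfolding path_potential_def pos_def power_add by auto
    moreover have "entry_G n u v = (if v \<le> 2 then x / 2 else y / 2)" if "v \<le> 6" for v
      using that True u xy by (auto simp: entry_G_def dist_G_def pos_def ndist_def)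
    ultimately show ?thesis
      unfolding sum_1_6 by (simp add: basis xy(1) rs(1) flip: y_def s_def)
  next
    case small: False
    \<comment> \<open>Places 6 and \<open>n + 1\<close> are \<open>n - 5\<close> apart, so entries
      between the two ends are \<open>z / 2\<close>.\<close>
    define z where "z = (1 / 2 :: real) ^ (n - 6)"
    have "Suc n - 6 = Suc (n - 6)" "Suc n - 7 = n - 6" using n by auto
    then have z: "(1 / 2 :: real) ^ (Suc n - 6) = z / 2" "(1 / 2 :: real) ^ (Suc n - 7) = z"
      by (simp_all add: z_def)
    show ?thesis
    proof (cases "u \<le> 2")
      case True
      have "path_potential ?p w0 (Suc n) = 3 * (1 / 2) ^ (Suc n - w0)"
        "path_potential ?p w0 7 = (1 / 2) ^ (Suc n - 7) * (1 / 2) ^ (w0 - 7)"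
        using True n w0 unfolding path_potential_def pos_def power_add by auto
      then have "path_potential ?p w0 (Suc n) = 3 * r / 2" "path_potential ?p w0 7 = s * z"
        unfolding rs z s_def by simp_all
      moreover have "entry_G n u v = (if u = v then 1 else if v \<le> 2 then 1 / 2 else z / 2)"
        if "1 \<le> v" "v \<le> 6" for v
        using that True u z n twins_le_2[of u v] by (auto simp: entry_G_def dist_G_def pos_def ndist_def)
      moreover have "u = 1 \<or> u = 2" using True u by auto
      ultimately show ?thesis
        unfolding sum_1_6 by (auto simp: basis)
    next
      case False
      have "path_potential ?p w0 (Suc n) = 4 * ((1 / 2) ^ (Suc n - 6) * (1 / 2) ^ (Suc n - w0))"
        "path_potential ?p w0 7 = 2 * (1 / 2) ^ (w0 - 6)"
        using False small n w0 unfolding path_potential_def pos_def power_add by auto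
      then have "path_potential ?p w0 (Suc n) = r * z" "path_potential ?p w0 7 = s"
        unfolding rs z by simp_all
      moreover have "entry_G n u v = (if v \<le> 2 then z / 2 else if u = v then 1 else if twins u v then 1 / 2 else 1 / 4)"
        if "v \<le> 6" for v
        using that False small z n by (auto simp: entry_G_def dist_G_def pos_def ndist_def power2_eq_square)
      moreover have "u = 3 \<or> u = 4 \<or> u = 5 \<or> u = 6" using False small by linarith
      ultimately show ?thesis
        unfolding sum_1_6 by (auto simp: basis twins_def)
    qed
  qed
  then show ?thesis
    unfolding sum_vertices_split[OF n, of "\<lambda>v. entry_G n u v * basis_G n v j"] L R C
    by linarith
qed

text \<open>From column 4 on, the basis vectors are unit vectors at path vertices. The path is a
  component, so they span an invariant subspace on which the path matrix acts.\<close>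

lemma invariant_H:
  assumes n: "n \<ge> 7" and u: "u \<in> {1..n}" and j: "j < n - 2"
  shows "(\<Sum>l<n. entry_H u (Suc l) * basis_H n (Suc l) j) =
    (\<Sum>l<n - 2. basis_H n u l * compression l j)"
proof (cases "j < 4")
  case True
  have L: "(\<Sum>w = 7..n. entry_H u w * basis_H n w j) = 0"
    using True by (intro sum.neutral) (auto simp: basis_H_def)
  have "(\<Sum>l<n - 2. basis_H n u l * compression l j) =
      (\<Sum>l<n - 2. if l = j then basis_H n u j * (if j = 3 then 1 else 1 / 2) else 0)"
    using True by (intro sum.cong) (auto simp: compression_def)
  also have "\<dots> = basis_H n u j * (if j = 3 then 1 else 1 / 2)"
    using j by simp
  finally have R: "(\<Sum>l<n - 2. basis_H n u l * compression l j) =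
      basis_H n u j * (if j = 3 then 1 else 1 / 2)" .
  have j': "j = 0 \<or> j = 1 \<or> j = 2 \<or> j = 3" using True by linarith
  have "1 \<le> u" using u by simp
  then show ?thesis
    unfolding sum_vertices_split[OF n, of "\<lambda>v. entry_H u v * basis_H n v j"] L R sum_1_6
    using j' n by (elim vertex_cases disjE) (simp_all add: basis_H_def entry_H_def dist_H6_def twins_def power2_eq_square)
next
  case False
  have b: "basis_H n v j = of_bool (v = j + 3)" for v
    using False j by (simp add: basis_H_def)
  have "(\<Sum>l<n. entry_H u (Suc l) * basis_H n (Suc l) j) = (\<Sum>w = 7..n. if w = j + 3 then entry_H u w else 0)"
    unfolding sum_vertices_split[OF n, of "\<lambda>v. entry_H u v * basis_H n v j"]
    using False by (auto simp: b sum_1_6 intro!: sum.cong)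
  also have "\<dots> = entry_H u (j + 3)"
    using False j by simp
  finally have L: "(\<Sum>l<n. entry_H u (Suc l) * basis_H n (Suc l) j) = entry_H u (j + 3)" .
  have "(\<Sum>l<n - 2. basis_H n u l * compression l j) =
      (\<Sum>w = 7..n. basis_H n u (w - 3) * compression (w - 3) j)"
    using sum_columns_split[OF n, of "\<lambda>l. basis_H n u l * compression l j"] False
    by (simp add: compression_def)
  also have "\<dots> = (\<Sum>w = 7..n. if w = u then (1 / 2) ^ ndist u (j + 3) else 0)"
  proof (rule sum.cong[OF refl])
    fix w assume "w \<in> {7..n}"
    moreover define l where "l = w - 3"
    ultimately have l: "w = l + 3" "4 \<le> l" "l < n - 2" by auto
    then show "basis_H n u (w - 3) * compression (w - 3) j =
        (if w = u then (1 / 2) ^ ndist u (j + 3) else 0)"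
      using False by (auto simp: compression_def basis_H_def ndist_def)
  qed
  also have "\<dots> = entry_H u (j + 3)"
    using False u by (auto simp: entry_H_def)
  finally show ?thesis using L by simp
qed

section \<open>Linear independence of the two families of columns\<close>

lemma det_nonzero_if_vertex_row_pivots:
  fixes f :: "nat \<Rightarrow> nat \<Rightarrow> 'a::field"
  assumes pivot: "\<And>j. j < n \<Longrightarrow> \<exists>a\<in>{1..n}. \<exists>b\<in>{1..n}. \<exists>c. f a j - c * f b j \<noteq> 0 \<and>
      (\<forall>l<n. j < l \<longrightarrow> f a l - c * f b l = 0)"
  shows "det (mat n n (\<lambda>(i, j). f (Suc i) j)) \<noteq> 0"
proof (rule det_nonzero_if_row_pivots)
  let ?S = "mat n n (\<lambda>(i, j). f (Suc i) j)"
  fix j assume j: "j < n"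
  obtain a b c where ab: "a \<in> {1..n}" "b \<in> {1..n}" and "f a j - c * f b j \<noteq> 0"
    "\<forall>l<n. j < l \<longrightarrow> f a l - c * f b l = 0" using pivot[OF j] by blast
  moreover have "a - 1 < n" "b - 1 < n" "Suc (a - 1) = a" "Suc (b - 1) = b" using ab by auto
  ultimately have "a - 1 < n \<and> b - 1 < n \<and> ?S $$ (a - 1, j) - c * ?S $$ (b - 1, j) \<noteq> 0 \<and>
      (\<forall>l<n. j < l \<longrightarrow> ?S $$ (a - 1, l) - c * ?S $$ (b - 1, l) = 0)"
    using j by simp
  then show "\<exists>a<n. \<exists>b<n. \<exists>c. ?S $$ (a, j) - c * ?S $$ (b, j) \<noteq> 0 \<and>
      (\<forall>l<n. j < l \<longrightarrow> ?S $$ (a, l) - c * ?S $$ (b, l) = 0)"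
    by blast
qed simp

text \<open>Vertices at one place have equal rows from column 4 on, so their differences give the
  first four pivots. Later pivots come from rows at consecutive places, which are proportional to
  the right of the pivot. The last column needs only one row.\<close>

lemma det_basis_G:
  assumes n: "n \<ge> 7"
  shows "det (mat n n (\<lambda>(i, j). basis_G n (Suc i) j)) \<noteq> 0"
proof (rule det_nonzero_if_vertex_row_pivots)
  fix j assume j: "j < n"
  show "\<exists>a\<in>{1..n}. \<exists>b\<in>{1..n}. \<exists>c. basis_G n a j - c * basis_G n b j \<noteq> 0 \<and>
      (\<forall>l<n. j < l \<longrightarrow> basis_G n a l - c * basis_G n b l = 0)"
  proof -
    consider "j = 0" | "j = 1" | "j = 2" | "j = 3" | "4 \<le> j" "j \<le> n - 2" | "j = n - 1" "4 \<le> j"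
      using j by linarith
    then show ?thesis
    proof cases
      case 1
      then show ?thesis using n
        by (intro bexI[of _ 1] bexI[of _ 2] exI[of _ 1]) (auto simp: basis_G_def pos_def)
    next
      case 2
      then show ?thesis using n
        by (intro bexI[of _ 3] bexI[of _ 4] exI[of _ 1]) (auto simp: basis_G_def pos_def)
    next
      case 3
      then show ?thesis using n
        by (intro bexI[of _ 5] bexI[of _ 6] exI[of _ 1]) (auto simp: basis_G_def pos_def)
    next
      case 4
      then show ?thesis using n
        by (intro bexI[of _ 3] bexI[of _ 5] exI[of _ 1]) (auto simp: basis_G_def pos_def)
    next
      case 5
      \<comment> \<open>Column \<open>j\<close> belongs to position \<open>j + 3\<close>, and
        \<open>a\<close>, \<open>b\<close> are vertices at places \<open>j + 2\<close>,
        \<open>j + 3\<close>. Beyond column \<open>j\<close> row \<open>a\<close> is half of row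
        \<open>b\<close>, while at column \<open>j\<close> the values are \<open>1 / 2\<close> and
        0. Vertices 3 and 1 represent the end places 6 and \<open>n + 1\<close>.\<close>
      define a where "a = (if j = 4 then 3 else j + 2)"
      define b where "b = (if j = n - 2 then 1 else j + 3)"
      have ab: "pos n a = j + 2" "pos n b = j + 3" "a \<in> {1..n}" "b \<in> {1..n}"
        using 5 n by (auto simp: a_def b_def pos_def)
      have "path_twist (j + 2) (l + 3) - 1 / 2 * path_twist (j + 3) (l + 3) = 0" if "j < l" for l
      proof -
        have "l + 3 - (j + 2) = Suc (l + 3 - (j + 3))" using that by linarith
        then show ?thesis using that by (simp add: path_twist_def)
      qed
      then show ?thesis using 5 ab
        by (intro bexI[of _ a] bexI[of _ b] exI[of _ "1 / 2"]) (auto simp: basis_G_def path_twist_def)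
    next
      case 6
      then show ?thesis using n
        by (intro bexI[of _ 1] exI[of _ 0]) (auto simp: basis_G_def pos_def path_twist_def)
    qed
  qed
qed

text \<open>Rows of twins differ only in the column of their difference, which gives the first three
  pivots. Every other column holds the last nonzero entry of a single row.\<close>

lemma det_basis_H:
  assumes n: "n \<ge> 7"
  shows "det (mat n n (\<lambda>(i, j). basis_H n (Suc i) j)) \<noteq> 0"
proof (rule det_nonzero_if_vertex_row_pivots)
  fix j assume j: "j < n"
  show "\<exists>a\<in>{1..n}. \<exists>b\<in>{1..n}. \<exists>c. basis_H n a j - c * basis_H n b j \<noteq> 0 \<and>
      (\<forall>l<n. j < l \<longrightarrow> basis_H n a l - c * basis_H n b l = 0)"
  proof -
    consider "j = 0" | "j = 1" | "j = 2" | "j = 3" | "4 \<le> j" "j < n - 2" | "j = n - 2" "4 \<le> j" | "j = n - 1" "4 \<le> j"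
      using j by linarith
    then show ?thesis
    proof cases
      case 1
      then show ?thesis using n
        by (intro bexI[of _ 1] bexI[of _ 2] exI[of _ 1]) (auto simp: basis_H_def)
    next
      case 2
      then show ?thesis using n
        by (intro bexI[of _ 5] bexI[of _ 6] exI[of _ 1]) (auto simp: basis_H_def)
    next
      case 3
      then show ?thesis using n
        by (intro bexI[of _ 3] bexI[of _ 4] exI[of _ 1]) (auto simp: basis_H_def)
    next
      case 4
      then show ?thesis using n
        by (intro bexI[of _ 5] exI[of _ 0]) (auto simp: basis_H_def)
    next
      case 5
      then show ?thesis using n
        by (intro bexI[of _ "j + 3"] bexI[of _ 1] exI[of _ 0]) (auto simp: basis_H_def)
    next
      case 6
      then show ?thesis using n
        by (intro bexI[of _ 1] exI[of _ 0]) (auto simp: basis_H_def)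
    next
      case 7
      then show ?thesis using n
        by (intro bexI[of _ 3] exI[of _ 0]) (auto simp: basis_H_def)
    qed
  qed
qed

subsection \<open>Traces of the squares\<close>

lemma entry_G_refl: "entry_G n v v = 1"
  by (simp add: entry_G_def dist_G_def)

lemma entry_H_refl: "entry_H v v = 1"
  by (simp add: entry_H_def dist_H6_def ndist_def)

lemma entry_G_sym: "entry_G n u v = entry_G n v u"
  by (auto simp: entry_G_def dist_G_def twins_sym ndist_def add.commute)

lemma entry_H_sym: "entry_H u v = entry_H v u"
  by (auto simp: entry_H_def dist_H6_def twins_sym ndist_def add.commute)

lemma sum_square_split:
  fixes e :: "nat \<Rightarrow> nat \<Rightarrow> real"
  assumes n: "n \<ge> 7" and sym: "\<And>u v. e u v = e v u"
  shows "(\<Sum>i<n. \<Sum>l<n. (e (Suc i) (Suc l))\<^sup>2) =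
    (\<Sum>v = 1..6. \<Sum>w = 1..6. (e v w)\<^sup>2) + 2 * (\<Sum>v = 1..6. \<Sum>w = 7..n. (e v w)\<^sup>2)
    + (\<Sum>v = 7..n. \<Sum>w = 7..n. (e v w)\<^sup>2)"
proof -
  have "(\<Sum>v = 7..n. \<Sum>w = 1..6. (e v w)\<^sup>2) = (\<Sum>w = 1..6. \<Sum>v = 7..n. (e v w)\<^sup>2)"
    by (rule sum.swap)
  also have "\<dots> = (\<Sum>v = 1..6. \<Sum>w = 7..n. (e v w)\<^sup>2)"
    by (intro sum.cong refl arg_cong[where f = "\<lambda>x. x\<^sup>2"] sym)
  finally have "(\<Sum>v = 7..n. \<Sum>w = 1..6. (e v w)\<^sup>2) = (\<Sum>v = 1..6. \<Sum>w = 7..n. (e v w)\<^sup>2)" .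
  moreover have "(\<Sum>i<n. \<Sum>l<n. (e (Suc i) (Suc l))\<^sup>2) =
      (\<Sum>i<n. (\<Sum>w = 1..6. (e (Suc i) w)\<^sup>2) + (\<Sum>w = 7..n. (e (Suc i) w)\<^sup>2))"
    by (intro sum.cong refl sum_vertices_split[OF n])
  moreover note sum_vertices_split[OF n, of "\<lambda>v. (\<Sum>w = 1..6. (e v w)\<^sup>2) + (\<Sum>w = 7..n. (e v w)\<^sup>2)"]
  ultimately show ?thesis
    by (simp add: sum.distrib)
qed

lemma sum_quarter_powers:
  "(\<Sum>w = 7..m + 6. ((1 / 2 :: real) ^ (w - 6))\<^sup>2) = (1 - ((1 / 2) ^ m)\<^sup>2) / 3"
proof (induction m)
  case (Suc m)
  have "{7..Suc m + 6} = insert (m + 7) {7..m + 6}" by auto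
  then have "(\<Sum>w = 7..Suc m + 6. ((1 / 2 :: real) ^ (w - 6))\<^sup>2) =
      ((1 / 2) ^ Suc m)\<^sup>2 + (1 - ((1 / 2) ^ m)\<^sup>2) / 3"
    using Suc.IH by simp
  moreover have "((1 / 2 :: real) ^ Suc m)\<^sup>2 = ((1 / 2) ^ m)\<^sup>2 / 4"
    by (simp add: power2_eq_square)
  ultimately show ?case by argo
qed simp

lemma sum_quarter_powers_reverse:
  "(\<Sum>w = 7..m + 6. ((1 / 2 :: real) ^ (m + 7 - w))\<^sup>2) = (1 - ((1 / 2) ^ m)\<^sup>2) / 3"
proof -
  have "(\<Sum>w = 7..m + 6. ((1 / 2 :: real) ^ (m + 7 - w))\<^sup>2) =
      (\<Sum>w = 7..m + 6. ((1 / 2 :: real) ^ (w - 6))\<^sup>2)"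
    \<comment> \<open>The map \<open>w\<close> to \<open>m + 13 - w\<close> reverses the interval
      from 7 to \<open>m + 6\<close>.\<close>
    by (rule sum.reindex_bij_witness[of _ "\<lambda>w. m + 13 - w" "\<lambda>w. m + 13 - w"]) (auto simp: add.commute)
  then show ?thesis by (simp add: sum_quarter_powers)
qed

text \<open>The path blocks agree. In \<open>G\<close> the block on \<open>1, ..., 6\<close> gives
  \<open>8 + 4 * x^2\<close> and the two mixed blocks give \<open>2 * (1 - x^2)\<close> each, for a
  total of 12; in \<open>H\<close> the block on \<open>1, ..., 6\<close> gives 12 and the mixed
  blocks vanish.\<close>

lemma sum_squares_eq:
  assumes n: "n \<ge> 7"
  shows "(\<Sum>i<n. \<Sum>l<n. (entry_G n (Suc i) (Suc l))\<^sup>2) = (\<Sum>i<n. \<Sum>l<n. (entry_H (Suc i) (Suc l))\<^sup>2)"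
proof -
  obtain m where m: "n = m + 6" using n le_Suc_ex[of 6 n] by (auto simp: add.commute)
  define x :: real where "x = (1 / 2) ^ m"
  have far: "ndist (Suc n) 6 = Suc m" "ndist 6 (Suc n) = Suc m"
    by (simp_all add: ndist_def m)
  have "(\<Sum>v = 7..n. \<Sum>w = 7..n. (entry_G n v w)\<^sup>2) = (\<Sum>v = 7..n. \<Sum>w = 7..n. (entry_H v w)\<^sup>2)"
    by (intro sum.cong refl) (auto simp: entry_G_path entry_H_def pos_def)
  moreover have "(\<Sum>v = 1..6. \<Sum>w = 7..n. (entry_H v w)\<^sup>2) = 0"
    by (intro sum.neutral ballI) (auto simp: entry_H_def)
  moreover have "(\<Sum>v = 1..6. \<Sum>w = 1..6. (entry_H v w)\<^sup>2) = 12"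
    unfolding sum_1_6 by (simp add: entry_H_def dist_H6_def twins_def power_divide)
  moreover have "(\<Sum>v = 1..6. \<Sum>w = 1..6. (entry_G n v w)\<^sup>2) = 8 + 4 * x\<^sup>2"
    unfolding sum_1_6 using n
    by (simp add: entry_G_def dist_G_def pos_def twins_def far x_def power_divide power_mult_distrib)
  moreover have "(\<Sum>v = 1..6. \<Sum>w = 7..n. (entry_G n v w)\<^sup>2) = 2 * (1 - x\<^sup>2)"
  proof -
    have "(\<Sum>w = 7..n. (entry_G n v w)\<^sup>2) = (1 - x\<^sup>2) / 3" if "v \<in> {1..6}" for v
    proof (cases "v \<le> 2")
      case True
      then have "(\<Sum>w = 7..n. (entry_G n v w)\<^sup>2) = (\<Sum>w = 7..m + 6. ((1 / 2) ^ (m + 7 - w))\<^sup>2)"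
        unfolding m by (intro sum.cong) (auto simp: entry_G_path pos_def ndist_def add.commute)
      then show ?thesis by (simp add: sum_quarter_powers_reverse x_def)
    next
      case False
      then have "(\<Sum>w = 7..n. (entry_G n v w)\<^sup>2) = (\<Sum>w = 7..m + 6. ((1 / 2) ^ (w - 6))\<^sup>2)"
        unfolding m using that by (intro sum.cong) (auto simp: entry_G_path pos_def ndist_def)
      then show ?thesis by (simp add: sum_quarter_powers x_def)
    qed
    then have "(\<Sum>v = 1..6. \<Sum>w = 7..n. (entry_G n v w)\<^sup>2) = (\<Sum>v = 1..6::nat. (1 - x\<^sup>2) / 3)"
      by (rule sum.cong[OF refl])
    then show ?thesis by simp
  qed
  ultimately show ?thesis
    unfolding sum_square_split[OF n, of "entry_G n", OF entry_G_sym]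
      sum_square_split[OF n, of entry_H, OF entry_H_sym]
    by simp
qed

theorem theorem5p2:
  fixes n :: nat
  assumes "n \<ge> 7"
  shows "exp_dist_cospectral (1 / 2) (graph_G n) (graph_H n)"
proof -
  have n: "n - 2 + 2 = n" using assms by simp
  let ?A = "exp_dist_matrix (1 / 2) (graph_G n)" and ?B = "exp_dist_matrix (1 / 2) (graph_H n)"
  let ?S = "mat n n (\<lambda>(i, j). basis_G n (Suc i) j)" and ?T = "mat n n (\<lambda>(i, j). basis_H n (Suc i) j)"
  let ?C = "mat (n - 2) (n - 2) (\<lambda>(l, j). compression l j)"
  note A = exp_dist_matrix_G[OF assms] and B = exp_dist_matrix_H[OF assms]
  have AB: "?A \<in> carrier_mat n n" "?B \<in> carrier_mat n n" by (simp_all add: A B)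
  have "char_poly ?A = char_poly ?B"
  proof (rule char_poly_eq_if_common_compression[where k = "n - 2" and S = ?S and T = ?T and C = ?C,
        unfolded n])
    fix i j assume ij: "i < n" "j < n - 2"
    show "(\<Sum>l<n. ?A $$ (i, l) * ?S $$ (l, j)) = (\<Sum>l<n - 2. ?S $$ (i, l) * ?C $$ (l, j))"
      using invariant_G[OF assms, of "Suc i" j] ij by (simp add: A)
    show "(\<Sum>l<n. ?B $$ (i, l) * ?T $$ (l, j)) = (\<Sum>l<n - 2. ?T $$ (i, l) * ?C $$ (l, j))"
      using invariant_H[OF assms, of "Suc i" j] ij by (simp add: B)
  next
    show "mat_trace ?A = mat_trace ?B"
      by (simp add: A B mat_trace_def entry_G_refl entry_H_refl)
    \<comment> \<open>By symmetry the trace of the square is the sum of the squared entries.\<close>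
    have "mat_trace (?A * ?A) = (\<Sum>i<n. \<Sum>l<n. (entry_G n (Suc i) (Suc l))\<^sup>2)"
      unfolding mat_trace_mult[OF AB(1) AB(1)]
      by (intro sum.cong refl) (auto simp: A power2_eq_square intro: entry_G_sym)
    moreover have "mat_trace (?B * ?B) = (\<Sum>i<n. \<Sum>l<n. (entry_H (Suc i) (Suc l))\<^sup>2)"
      unfolding mat_trace_mult[OF AB(2) AB(2)]
      by (intro sum.cong refl) (auto simp: B power2_eq_square intro: entry_H_sym)
    ultimately show "mat_trace (?A * ?A) = mat_trace (?B * ?B)"
      using sum_squares_eq[OF assms] by simp
  qed (use AB det_basis_G[OF assms] det_basis_H[OF assms] in simp_all)
  \<comment> \<open>Equality of the real characteristic polynomials carries over to the complex
    ones, whose roots are the eigenvalues.\<close>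
  then show ?thesis
    unfolding exp_dist_cospectral_def eigenvalues_mset_def
    by (simp add: of_real_hom.char_poly_hom[OF AB(1)] of_real_hom.char_poly_hom[OF AB(2)])
qed

end
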